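(* Let $n$ be an even positive integer. The fractions in reduced form with numerator $n$ whose odd greedy expansion has length $2$ are exactly those of the form \[ \frac{n}{n\Bigl(\prod_{i=1}^s p_i^{\lceil v_{p_i}(r)/2\rceil}\Bigr)(1+2t)-r}, \] where $r$ is any odd positive integer that is coprime to $n$ and less than $2n$, where $p_1,\dotsc,p_s$ are the (distinct) prime divisors of $r$ (the product being $1$ if $r=1$), and where $t$ is any nonnegative integer.
   Context: Odd greedy expansion: given a positive rational number $q$, define $x_1,x_2,\dots$ recursively: writing $R_i=q-\sum_{j=1}^{i-1}1/x_j$, if $R_i\ge 1$ let $x_i=1$, and if $0<R_i<1$ let $x_i$ be the unique odd positive integer with $\frac{1}{x_i}\le R_i<\frac{1}{x_i-2}$; the process stops when the remainder is $0$. The $x_i$ are the denominators of the odd greedy expansion of $q$ and the number of terms is its length. For a prime $p$ and nonzero integer $n$, $v_p(n)$ is the exponent of the largest power of $p$ dividing $n$. *)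

theory Defs
  imports Complex_Main "HOL-Computational_Algebra.Primes"
begin

definition odd_greedy_step :: "rat \<Rightarrow> nat \<Rightarrow> bool" where
  "odd_greedy_step R x \<longleftrightarrow>
     (if R \<ge> 1 then x = 1
      else odd x \<and> 1 / of_nat x \<le> R \<and> R < 1 / (of_nat x - 2))"

lemma odd_greedy_step_unique_exists:
  assumes "0 < R"
  shows "\<exists>!x. odd_greedy_step R x"
proof (cases "R \<ge> 1")
  case True
  then show ?thesis by (simp add: odd_greedy_step_def)
next
  case False
  define y where "y = 1 / R"
  have y: "y > 1" using False assms by (simp add: y_def)
  have eq: "odd_greedy_step R x \<longleftrightarrow> odd x \<and> y \<le> of_nat x \<and> of_nat x < y + 2" for x
  proof (cases "odd x")
    case True
    then have "x > 0" by (simp add: odd_pos)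
    then have 1: "1 / of_nat x \<le> R \<longleftrightarrow> y \<le> of_nat x"
      using assms by (simp add: y_def field_simps)
    show ?thesis
    proof (cases "x = 1")
      case True
      then show ?thesis using False y by (simp add: odd_greedy_step_def)
    next
      case neq: False
      with \<open>odd x\<close> have "x \<ge> 3" by (cases x rule: nat.exhaust) (auto elim!: oddE)
      then have "(of_nat x :: rat) \<ge> of_nat 3" using of_nat_le_iff by blast
      then have "R < 1 / (of_nat x - 2) \<longleftrightarrow> of_nat x < y + 2"
        using assms by (simp add: y_def field_simps)
      with 1 show ?thesis using False by (simp add: odd_greedy_step_def)
    qed
  next
    case even: False
    then show ?thesis using False by (simp add: odd_greedy_step_def)
  qed
  define k where "k = nat \<lceil>y\<rceil>"
  have k: "(of_nat k :: rat) = of_int \<lceil>y\<rceil>" using y by (simp add: k_def)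
  have k1: "y \<le> of_nat k" and k2: "of_nat k < y + 1" unfolding k by linarith+
  show ?thesis unfolding eq
  proof (rule ex_ex1I)
    show "\<exists>x. odd x \<and> y \<le> of_nat x \<and> of_nat x < y + 2"
    proof (cases "odd k")
      case True with k1 k2 show ?thesis by (intro exI[of _ k]) auto
    next
      case False with k1 k2 show ?thesis by (intro exI[of _ "k + 1"]) auto
    qed
  next
    fix a b :: nat
    assume a: "odd a \<and> y \<le> of_nat a \<and> of_nat a < y + 2"
      and b: "odd b \<and> y \<le> of_nat b \<and> of_nat b < y + 2"
    have "(of_nat a :: rat) < of_nat (b + 2)" "(of_nat b :: rat) < of_nat (a + 2)"
      using a b by auto
    then have "a < b + 2" "b < a + 2" unfolding of_nat_less_iff by auto
    moreover have "odd a" "odd b" using a b by auto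
    ultimately show "a = b" by presburger
  qed
qed

definition odd_greedy_remainder :: "rat \<Rightarrow> nat list \<Rightarrow> nat \<Rightarrow> rat" where
  "odd_greedy_remainder q xs i = q - (\<Sum>j<i. 1 / of_nat (xs ! j))"

text \<open>The process started at \<open>q\<close> terminates, and \<open>xs\<close> lists all the denominators it
  produces; indices start at \<open>0\<close>.\<close>

definition odd_greedy_expansion :: "rat \<Rightarrow> nat list \<Rightarrow> bool" where
  "odd_greedy_expansion q xs \<longleftrightarrow>
     q > 0 \<and>
     (\<forall>i<length xs. odd_greedy_remainder q xs i > 0 \<and>
        odd_greedy_step (odd_greedy_remainder q xs i) (xs ! i)) \<and>
     odd_greedy_remainder q xs (length xs) = 0"

lemma odd_greedy_expansion_unique:
  assumes xs: "odd_greedy_expansion q xs" and ys: "odd_greedy_expansion q ys"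
  shows "xs = ys"
proof -
  have agree: "i \<le> length xs \<Longrightarrow> i \<le> length ys \<Longrightarrow> \<forall>j<i. xs ! j = ys ! j" for i
  proof (induction i)
    case (Suc i)
    then have IH: "\<forall>j<i. xs ! j = ys ! j" by simp
    then have R: "odd_greedy_remainder q xs i = odd_greedy_remainder q ys i"
      by (simp add: odd_greedy_remainder_def)
    have "xs ! i = ys ! i"
      using Suc.prems xs ys R odd_greedy_step_unique_exists
      unfolding odd_greedy_expansion_def by (metis Suc_le_lessD)
    with IH show ?case by (simp add: less_Suc_eq)
  qed simp
  have R: "odd_greedy_remainder q xs i = odd_greedy_remainder q ys i"
    if "i \<le> length xs" "i \<le> length ys" for i
    using agree[OF that] by (simp add: odd_greedy_remainder_def)
  have "\<not> length xs < length ys" "\<not> length ys < length xs"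
    using xs ys R[of "length xs"] R[of "length ys"]
    unfolding odd_greedy_expansion_def by force+
  then have "length xs = length ys" by simp
  with agree[of "length xs"] show ?thesis by (simp add: list_eq_iff_nth_eq)
qed

definition has_odd_greedy_length :: "rat \<Rightarrow> nat \<Rightarrow> bool" where
  "has_odd_greedy_length q k \<longleftrightarrow> (\<exists>xs. odd_greedy_expansion q xs \<and> length xs = k)"

end

theory Submission
  imports Defs
begin

text \<open>If \<open>x\<close> is the first denominator for \<open>n / d\<close>, put \<open>r = n * x - d\<close>; the greedy condition says
  \<open>0 \<le> r < 2 * n\<close>. The remainder \<open>r / (d * x)\<close> is a unit fraction iff \<open>r\<close> divides \<open>d * x\<close>, and modulo
  \<open>r\<close> this product is \<open>n * x\<^sup>2\<close>. As \<open>r\<close> is coprime to \<open>n\<close>, the condition becomes \<open>r dvd x\<^sup>2\<close>, which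
  holds iff \<open>x\<close> is a multiple of the product of the \<open>p ^ \<lceil>v\<^sub>p(r) / 2\<rceil>\<close>.\<close>

section \<open>Greedy steps as integer inequalities, and expansions of length two\<close>

text \<open>Clearing denominators in \<open>1 / x \<le> n / d < 1 / (x - 2)\<close> gives the
  inequalities. They also cover \<open>d \<le> n\<close>, where \<open>n * x < 3 * n\<close> leaves
  only the odd value \<open>x = 1\<close>; for \<open>d > n\<close> both sides fail at
  \<open>x = 1\<close>.\<close>

lemma odd_greedy_step_iff:
  fixes n d x :: nat
  assumes "n > 0" "d > 0"
  shows "odd_greedy_step (of_nat n / of_nat d) x \<longleftrightarrow> odd x \<and> d \<le> n * x \<and> n * x < d + 2 * n"
proof (cases "d \<le> n")
  case True
  have ge1: "of_nat n / of_nat d \<ge> (1::rat)"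
    using True assms by (simp add: field_simps)
  have "x = 1" if "odd x" "n * x < d + 2 * n"
  proof -
    have "n * x < n * 3" using that True by linarith
    then have "x < 3" by simp
    with \<open>odd x\<close> show "x = 1" by presburger
  qed
  then show ?thesis
    using ge1 True assms by (auto simp: odd_greedy_step_def)
next
  case False
  have lt1: "\<not> of_nat n / of_nat d \<ge> (1::rat)"
    using False assms by (simp add: field_simps)
  show ?thesis
  proof (cases "odd x \<and> x \<noteq> 1")
    case True
    then have x3: "x \<ge> 3" by presburger
    then have c: "(of_nat x :: rat) - 2 = of_nat (x - 2)" "(of_nat (x - 2) :: rat) > 0"
      by (simp_all add: of_nat_diff)
    have pos: "(of_nat d :: rat) > 0" "(of_nat x :: rat) > 0"
      using assms x3 by simp_all
    have "1 / of_nat x \<le> (of_nat n / of_nat d :: rat) \<longleftrightarrow> (of_nat d :: rat) \<le> of_nat n * of_nat x"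
      using pos by (simp add: divide_simps)
    also have "\<dots> \<longleftrightarrow> d \<le> n * x"
      unfolding of_nat_mult[symmetric] of_nat_le_iff ..
    finally have 1: "1 / of_nat x \<le> (of_nat n / of_nat d :: rat) \<longleftrightarrow> d \<le> n * x" .
    have "(of_nat n / of_nat d :: rat) < 1 / of_nat (x - 2)
        \<longleftrightarrow> (of_nat n :: rat) * of_nat (x - 2) < of_nat d"
      using pos(1) c(2) by (simp add: divide_simps)
    also have "\<dots> \<longleftrightarrow> n * (x - 2) < d"
      unfolding of_nat_mult[symmetric] of_nat_less_iff ..
    also have "\<dots> \<longleftrightarrow> n * x < d + 2 * n"
    proof -
      obtain y where "x = y + 2" using x3 by (intro that[of "x - 2"]) simp
      then show ?thesis by (simp add: algebra_simps)
    qed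
    finally show ?thesis
      using 1 True lt1 by (simp add: odd_greedy_step_def c(1))
  next
    case triv: False
    then show ?thesis
      using lt1 False by (auto simp: odd_greedy_step_def)
  qed
qed

lemma odd_greedy_step_unit_fraction:
  assumes "odd y"
  shows "odd_greedy_step (1 / of_nat y) y"
  using odd_greedy_step_iff[of 1 y y] assms by (simp add: odd_pos)

lemma odd_greedy_step_imp_odd:
  assumes "odd_greedy_step R x"
  shows "odd x"
  using assms by (auto simp: odd_greedy_step_def split: if_splits)

text \<open>Only the first step imposes a size condition: a remainder \<open>1 / y\<close> with
  \<open>y\<close> odd is expanded by \<open>y\<close> itself, and conversely greedy denominators
  are always odd.\<close>

lemma has_odd_greedy_length_2_iff:
  "has_odd_greedy_length q 2 \<longleftrightarrow>
     (\<exists>x y. odd_greedy_step q x \<and> odd x \<and> odd y \<and> q = 1 / of_nat x + 1 / of_nat y)"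
proof
  assume "has_odd_greedy_length q 2"
  then obtain xs where xs: "odd_greedy_expansion q xs" "length xs = 2"
    by (auto simp: has_odd_greedy_length_def)
  have sums: "odd_greedy_remainder q xs 0 = q"
    "odd_greedy_remainder q xs 2 = q - (1 / of_nat (xs ! 0) + 1 / of_nat (xs ! 1))"
    by (simp_all add: odd_greedy_remainder_def numeral_2_eq_2)
  have steps: "odd_greedy_step q (xs ! 0)"
    "odd_greedy_step (odd_greedy_remainder q xs 1) (xs ! 1)"
    using xs sums unfolding odd_greedy_expansion_def by fastforce+
  moreover have "q = 1 / of_nat (xs ! 0) + 1 / of_nat (xs ! 1)"
    using xs sums unfolding odd_greedy_expansion_def by simp
  ultimately show "\<exists>x y. odd_greedy_step q x \<and> odd x \<and> odd y \<and> q = 1 / of_nat x + 1 / of_nat y"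
    using odd_greedy_step_imp_odd by blast
next
  assume "\<exists>x y. odd_greedy_step q x \<and> odd x \<and> odd y \<and> q = 1 / of_nat x + 1 / of_nat y"
  then obtain x y where xy: "odd_greedy_step q x" "odd x" "odd y" "q = 1 / of_nat x + 1 / of_nat y"
    by blast
  then have pos: "x > 0" "y > 0" by (auto simp: odd_pos)
  then have "q > 0" using xy(4) by (simp add: add_pos_pos)
  moreover have "odd_greedy_remainder q [x, y] 0 = q" "odd_greedy_remainder q [x, y] 1 = 1 / of_nat y"
    "odd_greedy_remainder q [x, y] 2 = 0"
    using xy(4) by (simp_all add: odd_greedy_remainder_def numeral_2_eq_2)
  ultimately have "odd_greedy_expansion q [x, y]"
    using xy pos odd_greedy_step_unit_fraction[OF xy(3)]
    by (auto simp: odd_greedy_expansion_def less_Suc_eq numeral_2_eq_2)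
  then show "has_odd_greedy_length q 2"
    unfolding has_odd_greedy_length_def by (intro exI[of _ "[x, y]"]) simp
qed

section \<open>The divisibility criterion for a reduced fraction\<close>

text \<open>Every divisor of \<open>n\<close> divides \<open>d + r\<close>, hence divides both
  summands or neither. Reducedness of \<open>n / d\<close> thus becomes a condition on
  \<open>r\<close>.\<close>

lemma coprime_summand_iff:
  fixes n d x r :: nat
  assumes "n * x = d + r"
  shows "coprime d n \<longleftrightarrow> coprime r n"
proof -
  have "c dvd d \<longleftrightarrow> c dvd r" if "c dvd n" for c
  proof -
    have "c dvd d + r" using that unfolding assms[symmetric] by simp
    then show ?thesis by (metis dvd_add_left_iff dvd_add_right_iff)
  qed
  then show ?thesis unfolding coprime_def by blast
qed

lemma dvd_linear_combination_mult_iff: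
  fixes n d x r :: nat
  assumes "n * x = d + r" "coprime r n"
  shows "r dvd d * x \<longleftrightarrow> r dvd x\<^sup>2"
proof -
  have "n * x\<^sup>2 = d * x + r * x"
    using assms(1) by (metis add_mult_distrib mult.assoc power2_eq_square)
  then have "r dvd d * x \<longleftrightarrow> r dvd n * x\<^sup>2"
    by (simp add: dvd_add_left_iff)
  also have "\<dots> \<longleftrightarrow> r dvd x\<^sup>2"
    using assms(2) by (rule coprime_dvd_mult_right_iff)
  finally show ?thesis .
qed

lemma has_odd_greedy_length_2_fraction_iff:
  fixes n d :: nat
  assumes "even n" "n > 0" "d > 0" "coprime n d"
  shows "has_odd_greedy_length (of_nat n / of_nat d) 2 \<longleftrightarrow>
    (\<exists>x r. odd x \<and> r > 0 \<and> r < 2 * n \<and> n * x = d + r \<and> r dvd x\<^sup>2)"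
proof -
  have "odd d" using assms(1,4) by (metis coprime_common_divisor odd_one)
  \<comment> \<open>Removing \<open>1 / x\<close> leaves the remainder \<open>r / (d * x)\<close>,
    so \<open>y\<close> has to be \<open>d * x / r\<close>.\<close>
  have sum_iff: "of_nat n / of_nat d = (1 / of_nat x + 1 / of_nat y :: rat) \<longleftrightarrow> r * y = d * x"
    if "n * x = d + r" "x > 0" "y > 0" for x y r :: nat
  proof -
    have nx: "(of_nat n * of_nat x :: rat) = of_nat d + of_nat r"
      using that(1) by (metis of_nat_add of_nat_mult)
    have "of_nat n / of_nat d = (1 / of_nat x + 1 / of_nat y :: rat) \<longleftrightarrow>
        (of_nat n * of_nat x) * of_nat y = (of_nat d * (of_nat x + of_nat y) :: rat)"
      using that(2,3) \<open>d > 0\<close> by (simp add: field_simps)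
    also have "\<dots> \<longleftrightarrow> (of_nat r * of_nat y :: rat) = of_nat d * of_nat x"
      unfolding nx by (simp add: algebra_simps)
    also have "\<dots> \<longleftrightarrow> r * y = d * x"
      unfolding of_nat_mult[symmetric] of_nat_eq_iff ..
    finally show ?thesis .
  qed
  have copr: "coprime r n" if "n * x = d + r" for x r :: nat
    using coprime_summand_iff[OF that] assms(4) by (simp add: coprime_commute)
  show ?thesis unfolding has_odd_greedy_length_2_iff odd_greedy_step_iff[OF assms(2,3)]
  proof (intro iffI; elim exE conjE)
    fix x y :: nat
    assume xy: "odd x" "odd y" "d \<le> n * x" "n * x < d + 2 * n"
      "of_nat n / of_nat d = (1 / of_nat x + 1 / of_nat y :: rat)"
    then obtain r where r: "n * x = d + r" by (metis le_Suc_ex)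
    have eq: "r * y = d * x" using sum_iff[OF r, of y] xy by (auto simp: odd_pos)
    then have "r dvd x\<^sup>2"
      using dvd_linear_combination_mult_iff[OF r copr[OF r]] by (metis dvd_triv_left)
    \<comment> \<open>\<open>r = 0\<close> would mean that the expansion stops after one
      term.\<close>
    moreover have "r > 0" using eq xy(1) \<open>d > 0\<close> by (cases "r = 0") (auto simp: odd_pos)
    ultimately show "\<exists>x r. odd x \<and> r > 0 \<and> r < 2 * n \<and> n * x = d + r \<and> r dvd x\<^sup>2"
      using xy r by (intro exI[of _ x] exI[of _ r]) auto
  next
    fix x r :: nat
    assume xr: "odd x" "r > 0" "r < 2 * n" "n * x = d + r" "r dvd x\<^sup>2"
    then obtain y where y: "r * y = d * x"
      using dvd_linear_combination_mult_iff[OF xr(4) copr[OF xr(4)]] by (metis dvdE)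
    \<comment> \<open>\<open>y\<close> divides the odd number \<open>d * x\<close>; the evenness of
      \<open>n\<close> enters here, through \<open>odd d\<close>.\<close>
    then have "odd y" using \<open>odd d\<close> xr(1) by (metis even_mult_iff)
    then show "\<exists>x y. (odd x \<and> d \<le> n * x \<and> n * x < d + 2 * n) \<and> odd x \<and> odd y \<and>
        of_nat n / of_nat d = (1 / of_nat x + 1 / of_nat y :: rat)"
      using xr y sum_iff[OF xr(4), of y] by (intro exI[of _ x] exI[of _ y]) (auto simp: odd_pos)
  qed
qed

section \<open>The least integer whose square is a multiple of \<open>r\<close>\<close>

text \<open>Replaces the real ceiling in the exponents by natural division, which linear arithmetic
  can handle.\<close>

lemma nat_ceiling_half: "nat \<lceil>real k / 2\<rceil> = (k + 1) div 2"
proof -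
  have "\<lceil>real k / 2\<rceil> = int ((k + 1) div 2)"
    by (rule ceiling_unique) (cases "even k"; auto elim!: evenE oddE)+
  then show ?thesis by simp
qed

text \<open>For \<open>r > 0\<close> this is the least positive integer whose square is divisible by
  \<open>r\<close>.\<close>

definition sqrt_radical :: "nat \<Rightarrow> nat" where
  "sqrt_radical r = (\<Prod>p\<in>prime_factors r. p ^ nat \<lceil>real (multiplicity p r) / 2\<rceil>)"

lemma sqrt_radical_pos: "sqrt_radical r > 0"
  unfolding sqrt_radical_def by (intro prod_pos) (auto simp: in_prime_factors_iff prime_gt_0_nat)

lemma multiplicity_sqrt_radical:
  assumes "prime p"
  shows "multiplicity p (sqrt_radical r) = (multiplicity p r + 1) div 2"
proof -
  have "multiplicity p (sqrt_radical r) =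
      (if p \<in> prime_factors r then nat \<lceil>real (multiplicity p r) / 2\<rceil> else 0)"
    unfolding sqrt_radical_def
    by (rule multiplicity_prod_prime_powers) (use assms in auto)
  \<comment> \<open>A prime outside \<open>prime_factors r\<close> has multiplicity 0 in
    \<open>r\<close>, and \<open>(0 + 1) div 2 = 0\<close> agrees with the default value.\<close>
  then show ?thesis
    using assms by (auto simp: nat_ceiling_half prime_factors_multiplicity)
qed

text \<open>Prime by prime, an exponent \<open>k\<close> satisfies \<open>k \<le> 2 * m\<close>
  exactly when its half, rounded up, is at most \<open>m\<close>.\<close>

lemma dvd_power2_iff_sqrt_radical_dvd:
  assumes "r > 0" "x > 0"
  shows "r dvd x\<^sup>2 \<longleftrightarrow> sqrt_radical r dvd x"
proof -
  have dvd_iff: "a dvd b \<longleftrightarrow> (\<forall>p. prime p \<longrightarrow> multiplicity p a \<le> multiplicity p b)"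
    if "a > 0" "b > 0" for a b :: nat
    using that multiplicity_le_imp_dvd[of a b] dvd_imp_multiplicity_le[of a b] by auto
  have "r dvd x\<^sup>2 \<longleftrightarrow> (\<forall>p. prime p \<longrightarrow> multiplicity p r \<le> 2 * multiplicity p x)"
    using assms by (simp add: dvd_iff prime_elem_multiplicity_power_distrib)
  also have "\<dots> \<longleftrightarrow> (\<forall>p. prime p \<longrightarrow> multiplicity p (sqrt_radical r) \<le> multiplicity p x)"
    by (intro all_cong1 imp_cong refl) (simp add: multiplicity_sqrt_radical; linarith)
  also have "\<dots> \<longleftrightarrow> sqrt_radical r dvd x"
    using assms sqrt_radical_pos by (simp add: dvd_iff)
  finally show ?thesis .
qed

text \<open>Makes the denominators of the family positive. If \<open>sqrt_radical r\<close> is 1,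
  then \<open>r\<close> divides 1 and \<open>r = 1 < n\<close>; otherwise
  \<open>n * sqrt_radical r\<close> is at least \<open>2 * n\<close>, which exceeds
  \<open>r\<close>.\<close>

lemma less_mult_sqrt_radical:
  assumes "odd r" "r < 2 * n" "n > 1" "m > 0"
  shows "r < n * (sqrt_radical r * m)"
proof -
  have "r dvd (sqrt_radical r)\<^sup>2"
    using assms by (simp add: dvd_power2_iff_sqrt_radical_dvd sqrt_radical_pos odd_pos)
  have "r < n * sqrt_radical r"
  proof (cases "sqrt_radical r = 1")
    case True
    with \<open>r dvd (sqrt_radical r)\<^sup>2\<close> show ?thesis using assms by simp
  next
    case False
    then have "sqrt_radical r \<ge> 2" using sqrt_radical_pos[of r] by linarith
    then have "n * 2 \<le> n * sqrt_radical r" by (rule mult_le_mono2)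
    then show ?thesis using assms by linarith
  qed
  also have "\<dots> \<le> n * (sqrt_radical r * m)" using assms by simp
  finally show ?thesis .
qed

section \<open>Reduced fractions and the parametrised family\<close>

lemma quotient_of_of_nat_divide:
  assumes "coprime n d" "d > 0"
  shows "quotient_of (of_nat n / of_nat d) = (int n, int d)"
proof -
  have "quotient_of (Fract (int n) (int d)) = (int n, int d)"
    using assms by (simp add: quotient_of_Fract normalize_def)
  then show ?thesis by (simp add: Fract_of_int_quotient)
qed

theorem theorem2p3:
  fixes n :: nat
  assumes "even n" and "n > 0"
  shows "{q :: rat. fst (quotient_of q) = int n \<and> has_odd_greedy_length q 2} =
    {of_nat n /
       (of_nat n * (\<Prod>p\<in>prime_factors r. of_nat p ^ nat \<lceil>real (multiplicity p r) / 2\<rceil>)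
          * (1 + 2 * of_nat t) - of_nat r)
     | (r :: nat) (t :: nat). odd r \<and> r > 0 \<and> coprime r n \<and> r < 2 * n}"
    (is "?L = ?R")
proof -
  \<comment> \<open>The premise is additive, so that no truncated subtraction on naturals has to be
    cast to \<open>rat\<close>.\<close>
  have denom: "of_nat n * (\<Prod>p\<in>prime_factors r. of_nat p ^ nat \<lceil>real (multiplicity p r) / 2\<rceil>)
      * (1 + 2 * of_nat t) - of_nat r = (of_nat d :: rat)"
    if "n * (sqrt_radical r * (1 + 2 * t)) = d + r" for r t d
  proof -
    have "(of_nat (n * (sqrt_radical r * (1 + 2 * t))) :: rat) = of_nat (d + r)"
      using that by (rule arg_cong)
    then show ?thesis by (simp add: sqrt_radical_def algebra_simps)
  qed
  show ?thesis
  proof (intro equalityI subsetI)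
    fix q assume "q \<in> ?L"
    then have q: "fst (quotient_of q) = int n" "has_odd_greedy_length q 2" by auto
    obtain d' where d': "quotient_of q = (int n, d')" using q(1) by (metis prod.collapse)
    define d where "d = nat d'"
    have "d' > 0" "coprime (int n) d'" "q = of_int (int n) / of_int d'"
      using d' quotient_of_denom_pos quotient_of_coprime quotient_of_div by blast+
    then have d: "d > 0" "coprime n d" "q = of_nat n / of_nat d"
      unfolding d_def by (auto simp flip: coprime_int_iff)
    obtain x r where xr: "odd x" "r > 0" "r < 2 * n" "n * x = d + r" "r dvd x\<^sup>2"
      using q(2) unfolding d(3) has_odd_greedy_length_2_fraction_iff[OF assms d(1,2)] by blast
    have "odd d" using assms(1) d(2) by (metis coprime_common_divisor odd_one)
    then have "odd r" using xr(4) assms(1) by (metis even_add even_mult_iff)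
    have "coprime r n"
      using coprime_summand_iff[OF xr(4)] d(2) by (simp add: coprime_commute)
    have "sqrt_radical r dvd x"
      using xr dvd_power2_iff_sqrt_radical_dvd by (simp add: odd_pos)
    \<comment> \<open>The cofactor \<open>m\<close> of the odd number \<open>x\<close> is odd, which
      supplies the parameter \<open>t\<close>.\<close>
    then obtain m where m: "x = sqrt_radical r * m" by blast
    with \<open>odd x\<close> have "odd m" by simp
    then obtain t where "m = 1 + 2 * t" by (metis oddE add.commute)
    with m xr(4) have "n * (sqrt_radical r * (1 + 2 * t)) = d + r" by simp
    note den = denom[OF this]
    show "q \<in> ?R"
      using \<open>odd r\<close> xr(2,3) \<open>coprime r n\<close>
      by (intro CollectI, rule_tac exI[of _ r], rule_tac exI[of _ t]) (simp only: den d(3) simp_thms)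
  next
    fix q assume "q \<in> ?R"
    then obtain r t :: nat where rt: "odd r" "r > 0" "coprime r n" "r < 2 * n"
      "q = of_nat n / (of_nat n *
          (\<Prod>p\<in>prime_factors r. of_nat p ^ nat \<lceil>real (multiplicity p r) / 2\<rceil>)
          * (1 + 2 * of_nat t) - of_nat r)"
      by blast
    define x where "x = sqrt_radical r * (1 + 2 * t)"
    \<comment> \<open>The subtraction is not truncated, since \<open>r < n * x\<close> is shown
      next; there \<open>n > 1\<close> holds because \<open>n\<close> is even and positive.\<close>
    define d where "d = n * x - r"
    have "n > 1" using assms by (cases "n = 1") auto
    then have "r < n * x" unfolding x_def using rt by (intro less_mult_sqrt_radical) auto
    then have d: "n * x = d + r" "d > 0" by (auto simp: d_def)
    have q: "q = of_nat n / of_nat d" using rt(5) denom[OF d(1)[unfolded x_def]] by simp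
    have "coprime n d"
      using coprime_summand_iff[OF d(1)] rt(3) by (simp add: coprime_commute)
    \<comment> \<open>The exponent of 2 is \<open>(0 + 1) div 2 = 0\<close>, as \<open>r\<close> is
      odd.\<close>
    have "odd (sqrt_radical r)"
    proof
      assume "even (sqrt_radical r)"
      then have "multiplicity 2 (sqrt_radical r) > 0"
        using sqrt_radical_pos[of r] by (simp add: prime_multiplicity_gt_zero_iff)
      moreover have "multiplicity 2 r = 0" using rt(1) by (simp add: not_dvd_imp_multiplicity_0)
      ultimately show False by (simp add: multiplicity_sqrt_radical)
    qed
    then have "odd x" by (simp add: x_def)
    moreover have "r dvd x\<^sup>2"
      using rt(2) \<open>odd x\<close> dvd_power2_iff_sqrt_radical_dvd[of r x] by (simp add: odd_pos x_def)
    ultimately have "has_odd_greedy_length q 2"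
      unfolding q has_odd_greedy_length_2_fraction_iff[OF assms d(2) \<open>coprime n d\<close>]
      using rt d(1) by blast
    then show "q \<in> ?L" using quotient_of_of_nat_divide[OF \<open>coprime n d\<close> d(2)] q by simp
  qed
qed

end
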